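(* Let $g:\mathbb{Z}^n \to \mathbb{R}\cup\{+\infty\}$ be a semi-strictly quasi L$^{\natural}$-convex function, and suppose that the initial vector $p^\circ\in\mathrm{dom}\, g$ in the algorithm SteepestDescentDown is an upper bound of some minimizer of $g$ (i.e., $p^\circ\ge p^*$ component-wise for some $p^*\in\arg\min g$). Then the algorithm outputs a minimizer of $g$ and terminates exactly in $\check\mu(p^\circ)+1$ iterations, where $$\check\mu(p)=\min\{\|p^*-p\|_\infty \mid p^*\in\arg\min g,\ p^*\le p\}.$$
   Context: Notation: $n$ is a positive integer, $N=\{1,\dots,n\}$; for $X\subseteq N$, $e_X\in\{0,1\}^n$ is the characteristic vector of $X$ ($e_X(i)=1$ if $i\in X$, and $e_X(i)=0$ otherwise); $\mathbf{1}=(1,\dots,1)$; $p\wedge q$ and $p\vee q$ denote the component-wise minimum and maximum of $p,q\in\mathbb{Z}^n$; $\|q\|_\infty=\max_{i\in N}|q(i)|$; inequalities between vectors are component-wise; $\mathrm{dom}\, g=\{p\in\mathbb{Z}^n\mid g(p)<+\infty\}$; $\arg\min g$ is the set of minimizers of $g$ (vectors in $\mathrm{dom}\, g$ attaining the minimum of $g$). Definition. A function $g:\mathbb{Z}^n\to\mathbb{R}\cup\{+\infty\}$ is semi-strictly quasi L$^{\natural}$-convex if for every $p,q\in\mathrm{dom}\, g$ and every nonnegative integer $\lambda$, both (I) and (II) hold: (I) at least one of the following holds: (a) $g(p)>g((p-\lambda\mathbf{1})\vee q)$; (b) $g(q)>g(p\wedge(q+\lambda\mathbf{1}))$; (c)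 $g(p)=g((p-\lambda\mathbf{1})\vee q)$ and $g(q)=g(p\wedge(q+\lambda\mathbf{1}))$. (II) at least one of the following holds: (a) $g(q)>g((p-\lambda\mathbf{1})\vee q)$; (b) $g(p)>g(p\wedge(q+\lambda\mathbf{1}))$; (c) $g(q)=g((p-\lambda\mathbf{1})\vee q)$ and $g(p)=g(p\wedge(q+\lambda\mathbf{1}))$. Algorithm SteepestDescentDown with initial vector $p^\circ$: Step 0: Set $p:=p^\circ$. Step 1: Find $X\subseteq N$ that minimizes $g(p-e_X)$ (ties are broken arbitrarily). Step 2: If $g(p-e_X)=g(p)$, then output $p$ and stop. Step 3: Set $p:=p-e_X$ and go to Step 1. The number of iterations is the number of times Step 1 is executed (including the last execution, after which the algorithm stops in Step 2). *)

theory Defs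
  imports "HOL-Analysis.Analysis"
begin

(* Z^n is the type int ^ 'n, the index type 'n playing the role of N. The library provides inf and
   sup on vectors only over ordered Euclidean spaces, which excludes int ^ 'n. *)
definition vmeet :: "int ^ 'n \<Rightarrow> int ^ 'n \<Rightarrow> int ^ 'n" where
  "vmeet p q = (\<chi> i. min (p $ i) (q $ i))"

definition vjoin :: "int ^ 'n \<Rightarrow> int ^ 'n \<Rightarrow> int ^ 'n" where
  "vjoin p q = (\<chi> i. max (p $ i) (q $ i))"

definition char_vec :: "'n set \<Rightarrow> int ^ 'n" where
  "char_vec X = (\<chi> i. if i \<in> X then 1 else 0)"

definition linf_norm :: "int ^ 'n \<Rightarrow> nat" where
  "linf_norm q = nat (MAX i. \<bar>q $ i\<bar>)"

definition effdom :: "(int ^ 'n \<Rightarrow> ereal) \<Rightarrow> (int ^ 'n) set" where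
  "effdom g = {p. g p < \<infinity>}"

definition argmin :: "(int ^ 'n \<Rightarrow> ereal) \<Rightarrow> (int ^ 'n) set" where
  "argmin g = {p \<in> effdom g. \<forall>q. g p \<le> g q}"

(* vec (int l) is the constant vector with all components equal to l. *)
definition semistrictly_quasi_Lnat_convex :: "(int ^ 'n \<Rightarrow> ereal) \<Rightarrow> bool" where
  "semistrictly_quasi_Lnat_convex g \<longleftrightarrow>
    (\<forall>p \<in> effdom g. \<forall>q \<in> effdom g. \<forall>l :: nat.
      (let u = vjoin (p - vec (int l)) q; v = vmeet p (q + vec (int l)) in
        (g p > g u \<or> g q > g v \<or> (g p = g u \<and> g q = g v)) \<and>
        (g q > g u \<or> g p > g v \<or> (g q = g u \<and> g p = g v))))"

(* In both constructors the counter is the number of executions of Step 1 so far. *)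
datatype 'n state = Running "int ^ 'n" nat | Halted "int ^ 'n" nat

(* One iteration of SteepestDescentDown. The relation is nondeterministic: every minimizing X is
   allowed, so that arbitrary tie-breaking, including history-dependent tie-breaking, is covered. *)
inductive sdd_step :: "(int ^ 'n \<Rightarrow> ereal) \<Rightarrow> 'n state \<Rightarrow> 'n state \<Rightarrow> bool"
  for g :: "int ^ 'n \<Rightarrow> ereal" where
  stop: "\<lbrakk>\<forall>Y. g (p - char_vec X) \<le> g (p - char_vec Y); g (p - char_vec X) = g p\<rbrakk>
    \<Longrightarrow> sdd_step g (Running p k) (Halted p (Suc k))"
| continue: "\<lbrakk>\<forall>Y. g (p - char_vec X) \<le> g (p - char_vec Y); g (p - char_vec X) \<noteq> g p\<rbrakk>
    \<Longrightarrow> sdd_step g (Running p k) (Running (p - char_vec X) (Suc k))"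

definition mu_check :: "(int ^ 'n \<Rightarrow> ereal) \<Rightarrow> int ^ 'n \<Rightarrow> nat" where
  "mu_check g p = (LEAST m. \<exists>p' \<in> argmin g. p' \<le> p \<and> m = linf_norm (p' - p))"

end

theory Submission
  imports Defs
begin

text \<open>
  The proof shows that every iteration lowers \<open>mu_check\<close> by exactly one while it is positive, and
  that the algorithm stops in the iteration in which it is zero.

  The convexity condition is applied only to pairs in which one vector is a minimizer \<open>q\<close>. Since
  nothing lies below \<open>g q\<close>, condition (II) becomes an exchange principle: either the other vector
  strictly improves, or the vector paired with \<open>q\<close> is again a minimizer (lemmas
  \<open>minimizer_shifted_join\<close> and \<open>minimizer_shifted_meet\<close>).

  Let \<open>m > 0\<close> be the distance from \<open>p\<close> to the nearest minimizer \<open>q \<le> p\<close>. With shift \<open>m - 1\<close>, the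
  join of \<open>p\<close> and \<open>q\<close> lies below \<open>p\<close> at distance less than \<open>m\<close>, so it is not a minimizer;
  hence the meet improves on \<open>p\<close>. That meet has the form \<open>p - char_vec Y\<close>, so a steepest step is a
  strict descent. For a steepest step to \<open>p' = p - char_vec X\<close>, however the tie was broken, a
  minimizer within distance \<open>m - 1\<close> below \<open>p'\<close> arises in two exchanges: the meet with \<open>p'\<close> moves
  \<open>q\<close> below \<open>p'\<close>, and the shifted join then raises it to within \<open>m - 1\<close> of \<open>p'\<close>. In both, the strict
  alternative is excluded because it would give a vector \<open>p - char_vec Y\<close> better than \<open>p'\<close>. The
  distance cannot shrink by more than one, by the triangle inequality (\<open>mu_check_steepest_step\<close>).
\<close>

section \<open>The distance to the minimizers below a vector\<close>

lemma linf_norm_le_iff: "linf_norm q \<le> m \<longleftrightarrow> (\<forall>i. \<bar>q $ i\<bar> \<le> int m)"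
  by (simp add: linf_norm_def nat_le_iff)

lemma mu_check_le:
  assumes "q \<in> argmin g" "q \<le> p" "\<And>i. p $ i - int m \<le> q $ i"
  shows "mu_check g p \<le> m"
proof -
  have "mu_check g p \<le> linf_norm (q - p)"
    unfolding mu_check_def using assms(1,2) by (intro Least_le) blast
  also have "\<dots> \<le> m"
    unfolding linf_norm_le_iff
  proof
    fix i
    show "\<bar>(q - p) $ i\<bar> \<le> int m"
      using assms(3)[of i] assms(2) by (simp add: less_eq_vec_def abs_le_iff)
  qed
  finally show ?thesis .
qed

lemma mu_check_attained:
  assumes "\<exists>q \<in> argmin g. q \<le> p"
  obtains q where "q \<in> argmin g" "q \<le> p" "\<And>i. p $ i - int (mu_check g p) \<le> q $ i"
proof -
  have "\<exists>q \<in> argmin g. q \<le> p \<and> mu_check g p = linf_norm (q - p)"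
    unfolding mu_check_def by (rule LeastI_ex) (use assms in blast)
  then obtain q where q: "q \<in> argmin g" "q \<le> p" "linf_norm (q - p) \<le> mu_check g p"
    by auto
  have "p $ i - int (mu_check g p) \<le> q $ i" for i
    using q(3)[unfolded linf_norm_le_iff, rule_format, of i] by simp
  with q that show thesis by blast
qed

lemma argmin_if_mu_check_0:
  assumes "\<exists>q \<in> argmin g. q \<le> p" "mu_check g p = 0"
  shows "p \<in> argmin g"
proof -
  obtain q where q: "q \<in> argmin g" "q \<le> p" "\<And>i. p $ i - int (mu_check g p) \<le> q $ i"
    using mu_check_attained[OF assms(1)] by blast
  have "p \<le> q"
    using q(3) assms(2) by (simp add: less_eq_vec_def)
  then show ?thesis using q(1,2) by simp
qed

section \<open>Exchange with a minimizer\<close>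

lemma argmin_le: "q \<in> argmin g \<Longrightarrow> g q \<le> g r"
  by (simp add: argmin_def)

lemma argmin_if_eq_value: "\<lbrakk>q \<in> argmin g; g r = g q\<rbrakk> \<Longrightarrow> r \<in> argmin g"
  by (simp add: argmin_def effdom_def)

lemma minimizer_shifted_join:
  assumes "semistrictly_quasi_Lnat_convex g" "p \<in> effdom g" "q \<in> argmin g"
    and "g p \<le> g (vmeet p (q + vec (int l)))"
  shows "vjoin (p - vec (int l)) q \<in> argmin g"
proof -
  let ?u = "vjoin (p - vec (int l)) q"
  let ?v = "vmeet p (q + vec (int l))"
  have "q \<in> effdom g" using assms(3) by (simp add: argmin_def)
  then have "g q > g ?u \<or> g p > g ?v \<or> (g q = g ?u \<and> g p = g ?v)"
    using assms(1,2) unfolding semistrictly_quasi_Lnat_convex_def Let_def by blast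
  then have "g ?u = g q"
    using argmin_le[OF assms(3), of ?u] assms(4) by auto
  then show ?thesis by (rule argmin_if_eq_value[OF assms(3)])
qed

lemma minimizer_shifted_meet:
  assumes "semistrictly_quasi_Lnat_convex g" "q \<in> argmin g" "p \<in> effdom g"
    and "g p \<le> g (vjoin (q - vec (int l)) p)"
  shows "vmeet q (p + vec (int l)) \<in> argmin g"
proof -
  let ?u = "vjoin (q - vec (int l)) p"
  let ?v = "vmeet q (p + vec (int l))"
  have "q \<in> effdom g" using assms(2) by (simp add: argmin_def)
  then have "g p > g ?u \<or> g q > g ?v \<or> (g p = g ?u \<and> g q = g ?v)"
    using assms(1,3) unfolding semistrictly_quasi_Lnat_convex_def Let_def by blast
  then have "g ?v = g q"
    using argmin_le[OF assms(2), of ?v] assms(4) by auto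
  then show ?thesis by (rule argmin_if_eq_value[OF assms(2)])
qed

section \<open>A steepest step\<close>

lemma steepest_le:
  assumes "\<forall>Y. g (p - char_vec X) \<le> g (p - char_vec Y)"
    and "\<And>i. w $ i = p $ i \<or> w $ i = p $ i - 1"
  shows "g (p - char_vec X) \<le> g w"
proof -
  have "w = p - char_vec {i. w $ i = p $ i - 1}"
    using assms(2) by (auto simp: vec_eq_iff char_vec_def)
  then show ?thesis using assms(1) by metis
qed

lemma steepest_le_current:
  assumes "\<forall>Y. g (p - char_vec X) \<le> g (p - char_vec Y)"
  shows "g (p - char_vec X) \<le> g p"
  using assms by (rule steepest_le) simp

lemma ex_steepest: "\<exists>X. \<forall>Y. g (p - char_vec X) \<le> g (p - char_vec Y)"
  for g :: "int ^ 'n \<Rightarrow> ereal"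
proof -
  let ?S = "range (\<lambda>X. g (p - char_vec X))"
  have "Min ?S \<in> ?S" by (rule Min_in) auto
  then obtain X where X: "Min ?S = g (p - char_vec X)" by (rule rangeE)
  have "\<forall>Y. g (p - char_vec X) \<le> g (p - char_vec Y)"
    unfolding X[symmetric] by simp
  then show ?thesis ..
qed

text \<open>
  The join of \<open>p\<close> and the nearest minimizer, shifted by \<open>mu_check g p - 1\<close>, is too close to \<open>p\<close> to be
  a minimizer, so the exchange principle makes the corresponding meet a strict improvement, and
  this meet differs from \<open>p\<close> by a characteristic vector.
\<close>
lemma steepest_step_descends:
  assumes conv: "semistrictly_quasi_Lnat_convex g" and p: "p \<in> effdom g"
    and ex: "\<exists>q \<in> argmin g. q \<le> p" and pos: "mu_check g p = Suc m"
    and X: "\<forall>Y. g (p - char_vec X) \<le> g (p - char_vec Y)"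
  shows "g (p - char_vec X) < g p"
proof -
  obtain q where q: "q \<in> argmin g" "q \<le> p" "\<And>i. p $ i - int (mu_check g p) \<le> q $ i"
    using mu_check_attained[OF ex] by blast
  have qp: "q $ i \<le> p $ i" for i using q(2) by (simp add: less_eq_vec_def)
  let ?u = "vjoin (p - vec (int m)) q"
  let ?v = "vmeet p (q + vec (int m))"
  have "?u \<notin> argmin g"
  proof
    assume "?u \<in> argmin g"
    then have "mu_check g p \<le> m"
      by (rule mu_check_le) (use qp in \<open>auto simp: less_eq_vec_def vjoin_def\<close>)
    then show False using pos by simp
  qed
  then have "g ?v < g p"
    using minimizer_shifted_join[OF conv p q(1)] not_le by blast
  moreover have "g (p - char_vec X) \<le> g ?v"
  proof (rule steepest_le[OF X])
    fix i
    show "?v $ i = p $ i \<or> ?v $ i = p $ i - 1"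
      using qp[of i] q(3)[of i] pos by (auto simp: vmeet_def min_def)
  qed
  ultimately show ?thesis by simp
qed

text \<open>
  A nearest minimizer \<open>q\<close> below \<open>p\<close> need not lie below the new vector \<open>p'\<close>, nor be closer to it
  than to \<open>p\<close>; the first defect occurs at coordinates of \<open>X\<close> where \<open>q\<close> agrees with \<open>p\<close>, the second at
  coordinates outside \<open>X\<close> where \<open>q\<close> is farthest from \<open>p\<close>. Each is repaired by an exchange
  with \<open>p'\<close> whose other outcome again differs from \<open>p\<close> by a characteristic vector, and so cannot
  improve on \<open>p'\<close>.
\<close>
lemma mu_check_steepest_step:
  assumes conv: "semistrictly_quasi_Lnat_convex g" and p: "p \<in> effdom g"
    and ex: "\<exists>q \<in> argmin g. q \<le> p" and pos: "mu_check g p = Suc m"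
    and X: "\<forall>Y. g (p - char_vec X) \<le> g (p - char_vec Y)"
  shows "\<exists>q \<in> argmin g. q \<le> p - char_vec X" and "mu_check g (p - char_vec X) = m"
proof -
  define p' where "p' = p - char_vec X"
  have p'_i: "p' $ i = (if i \<in> X then p $ i - 1 else p $ i)" for i
    by (simp add: p'_def char_vec_def)
  have p': "p' \<in> effdom g"
    using steepest_le_current[OF X] p by (auto simp: effdom_def p'_def)
  obtain q where q: "q \<in> argmin g" "q \<le> p" "\<And>i. p $ i - int (mu_check g p) \<le> q $ i"
    using mu_check_attained[OF ex] by blast
  have qp: "q $ i \<le> p $ i" for i using q(2) by (simp add: less_eq_vec_def)

  define r where "r = vmeet q p'"
  have "g p' \<le> g (vjoin q p')"
    unfolding p'_def
  proof (rule steepest_le[OF X])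
    fix i
    show "vjoin q (p - char_vec X) $ i = p $ i \<or> vjoin q (p - char_vec X) $ i = p $ i - 1"
      using qp[of i] by (auto simp: vjoin_def max_def char_vec_def)
  qed
  then have r: "r \<in> argmin g"
    using minimizer_shifted_meet[OF conv q(1) p', of 0] by (simp add: r_def)
  have r_i: "r $ i \<le> p' $ i" "p $ i - int (Suc m) \<le> r $ i" for i
    using q(3)[of i] pos by (auto simp: r_def vmeet_def p'_i)

  define s where "s = vjoin (p' - vec (int m)) r"
  have "g p' \<le> g (vmeet p' (r + vec (int m)))"
    unfolding p'_def
  proof (rule steepest_le[OF X], fold p'_def)
    fix i
    show "vmeet p' (r + vec (int m)) $ i = p $ i \<or> vmeet p' (r + vec (int m)) $ i = p $ i - 1"
      using r_i[of i] by (auto simp: vmeet_def min_def p'_i)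
  qed
  then have s: "s \<in> argmin g"
    unfolding s_def by (rule minimizer_shifted_join[OF conv p' r])
  have s_le: "s \<le> p'"
    using r_i(1) by (auto simp: s_def less_eq_vec_def vjoin_def)
  show ex': "\<exists>q \<in> argmin g. q \<le> p - char_vec X"
    using s s_le unfolding p'_def by blast
  have upper: "mu_check g p' \<le> m"
    using s s_le by (rule mu_check_le) (simp add: s_def vjoin_def)

  obtain t where t: "t \<in> argmin g" "t \<le> p'" "\<And>i. p' $ i - int (mu_check g p') \<le> t $ i"
    using mu_check_attained[OF ex'] unfolding p'_def by blast
  have "mu_check g p \<le> Suc (mu_check g p')"
  proof (rule mu_check_le[OF t(1)])
    have "t $ i \<le> p $ i" for i
    proof -
      have "t $ i \<le> p' $ i" using t(2) by (simp add: less_eq_vec_def)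
      then show ?thesis by (simp add: p'_i split: if_splits)
    qed
    then show "t \<le> p" by (simp add: less_eq_vec_def)
    show "p $ i - int (Suc (mu_check g p')) \<le> t $ i" for i
      using t(3)[of i] by (simp add: p'_i split: if_splits)
  qed
  with upper pos show "mu_check g (p - char_vec X) = m" unfolding p'_def by simp
qed

section \<open>Runs of the algorithm\<close>

text \<open>
  The invariant of a run: the iterations done so far and those still due to the distance add up
  to the initial distance, and the algorithm halts only in the iteration after the distance is
  used up.
\<close>
definition run_invariant :: "(int ^ 'n \<Rightarrow> ereal) \<Rightarrow> nat \<Rightarrow> 'n state \<Rightarrow> bool" where
  "run_invariant g M t \<longleftrightarrow> (case t of
      Running p k \<Rightarrow> p \<in> effdom g \<and> (\<exists>q \<in> argmin g. q \<le> p) \<and> k + mu_check g p = M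
    | Halted q k \<Rightarrow> q \<in> argmin g \<and> k = Suc M)"

lemma run_invariant_step:
  assumes conv: "semistrictly_quasi_Lnat_convex g"
    and "sdd_step g t t'" "run_invariant g M t"
  shows "run_invariant g M t'"
  using assms(2,3)
proof cases
  case (stop p X k)
  then have p: "p \<in> effdom g" "\<exists>q \<in> argmin g. q \<le> p" "k + mu_check g p = M"
    using assms(3) by (simp_all add: run_invariant_def)
  have "mu_check g p = 0"
  proof (cases "mu_check g p")
    case (Suc m)
    then show ?thesis
      using steepest_step_descends[OF conv p(1,2) Suc stop(3)] stop(4) by simp
  qed
  with p stop show ?thesis
    by (simp add: run_invariant_def argmin_if_mu_check_0)
next
  case (continue p X k)
  then have p: "p \<in> effdom g" "\<exists>q \<in> argmin g. q \<le> p" "k + mu_check g p = M"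
    using assms(3) by (simp_all add: run_invariant_def)
  have le: "g (p - char_vec X) \<le> g p"
    using continue(3) by (rule steepest_le_current)
  show ?thesis
  proof (cases "mu_check g p")
    case 0
    then have "g p \<le> g (p - char_vec X)"
      using argmin_if_mu_check_0[OF p(2)] argmin_le by blast
    with le continue(4) show ?thesis by simp
  next
    case (Suc m)
    have "p - char_vec X \<in> effdom g" using le p(1) by (auto simp: effdom_def)
    with mu_check_steepest_step[OF conv p(1,2) Suc continue(3)] Suc p(3) continue(2)
    show ?thesis by (simp add: run_invariant_def)
  qed
qed

lemma run_invariant_reachable:
  assumes "semistrictly_quasi_Lnat_convex g"
    and "(sdd_step g)\<^sup>*\<^sup>* t t'" "run_invariant g M t"
  shows "run_invariant g M t'"
  using assms(2,3) by induction (blast intro: run_invariant_step[OF assms(1)])+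

lemma Running_has_step: "\<exists>t'. sdd_step g (Running p k) t'"
proof -
  obtain X where "\<forall>Y. g (p - char_vec X) \<le> g (p - char_vec Y)"
    using ex_steepest by blast
  then show ?thesis by (cases "g (p - char_vec X) = g p") (blast intro: sdd_step.intros)+
qed

lemma infinite_run_Running:
  assumes "s 0 = Running p 0" "\<And>i. sdd_step g (s i) (s (Suc i))"
  shows "\<exists>q. s i = Running q i"
proof (induction i)
  case 0
  then show ?case using assms(1) by simp
next
  case (Suc i)
  \<comment> \<open>The state \<open>s (Suc i)\<close> itself makes a step, so it is not halted.\<close>
  show ?case using Suc assms(2)[of i] assms(2)[of "Suc i"]
    by (auto elim!: sdd_step.cases)
qed

theorem theorem1p4:
  fixes g :: "int ^ 'n \<Rightarrow> ereal" and p0 :: "int ^ 'n"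
  assumes "\<And>p. g p \<noteq> -\<infinity>"
    and "semistrictly_quasi_Lnat_convex g"
    and "p0 \<in> effdom g"
    and "\<exists>p' \<in> argmin g. p' \<le> p0"
  shows "(\<nexists>s. s 0 = Running p0 0 \<and> (\<forall>i :: nat. sdd_step g (s i) (s (Suc i)))) \<and>
    (\<forall>t. (sdd_step g)\<^sup>*\<^sup>* (Running p0 0) t \<and> (\<nexists>t'. sdd_step g t t') \<longrightarrow>
      (\<exists>q \<in> argmin g. t = Halted q (mu_check g p0 + 1)))"
proof (intro conjI allI impI notI)
  let ?M = "mu_check g p0"
  have init: "run_invariant g ?M (Running p0 0)"
    using assms(3,4) by (simp add: run_invariant_def)
  {
    assume "\<exists>s. s 0 = Running p0 0 \<and> (\<forall>i :: nat. sdd_step g (s i) (s (Suc i)))"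
    then obtain s where s: "s 0 = Running p0 0" "\<And>i :: nat. sdd_step g (s i) (s (Suc i))"
      by blast
    have "run_invariant g ?M (s i)" for i
    proof (induction i)
      case 0
      then show ?case using init s(1) by simp
    next
      case (Suc i)
      then show ?case using run_invariant_step[OF assms(2) s(2)] by blast
    qed
    \<comment> \<open>A run still going after \<open>Suc ?M\<close> iterations would leave a negative distance.\<close>
    then have "run_invariant g ?M (s (Suc ?M))" .
    moreover obtain q where "s (Suc ?M) = Running q (Suc ?M)"
      using infinite_run_Running[where s = s and i = "Suc ?M", OF s] by blast
    ultimately show False by (simp add: run_invariant_def)
  next
    fix t
    assume t: "(sdd_step g)\<^sup>*\<^sup>* (Running p0 0) t \<and> (\<nexists>t'. sdd_step g t t')"
    then have "run_invariant g ?M t"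
      using run_invariant_reachable[OF assms(2) _ init] by blast
    then show "\<exists>q \<in> argmin g. t = Halted q (?M + 1)"
      using t Running_has_step[of g] by (cases t) (auto simp: run_invariant_def)
  }
qed

end
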